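(* In the Euclidean plane, let a square grid (evenly spaced horizontal and vertical lines forming square cells) be given, and let $\mathcal{C}$ be a circle of radius $r>0$ centered at a point $A$ of the plane. For two adjacent parallel lines $s,t$ of the grid, let $s',t'$ be the inverses of $s$ and $t$ with respect to $\mathcal{C}$, and let $\kappa_{s'},\kappa_{t'}$ be their (signed) curvatures. Then $|\kappa_{t'}-\kappa_{s'}|$ is a constant independent of the choice of the pair $s,t$ of adjacent parallel grid lines.
   Context: The grid is infinite. Two grid lines are adjacent if they are consecutive parallel lines of the grid. Inversion with respect to the circle $\mathcal{C}$ of center $A$ and radius $r$ sends a point $X\neq A$ to the point $X'$ on the ray from $A$ through $X$ with $\overline{AX}\cdot\overline{AX'}=r^2$; a line through $A$ is its own inverse, and a line not through $A$ is inverted to a circle through $A$ (with $A$ corresponding to the point at infinity). "Circle" means generalized circle, i.e. a circle or a straight line. Sign convention for the curvature of the inverses of grid lines: a straight line has curvature $0$. Take the coordinate system with origin $A$, with horizontal axis $p$ and vertical axis $p'$. The inverse of a vertical grid line not through $A$ is a circle through $A$ centered at a point of $p$, and the inverse of a horizontal grid line not through $A$ is a circle through $A$ centered at a point of $p'$. The curvature of such a circle is $\pm 1/(\text{radius})$, with the sign being that of the coordinate of its center on $p$ (respectively on $p'$). Thus circles lying on opposite sides of $A$ have curvatures of opposite signs. *)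

theory Defs
  imports "HOL-Analysis.Analysis"
begin

text \<open>
  The Euclidean plane is \<^typ>\<open>real^2\<close>; the first coordinate is the horizontal one.
  A square grid is given by one of its vertices \<open>V\<close> and the side length \<open>d > 0\<close> of its cells.
\<close>

definition vertical_grid_line :: "real^2 \<Rightarrow> real \<Rightarrow> int \<Rightarrow> (real^2) set" where
  "vertical_grid_line V d m = {P. P $ 1 = V $ 1 + of_int m * d}"

definition horizontal_grid_line :: "real^2 \<Rightarrow> real \<Rightarrow> int \<Rightarrow> (real^2) set" where
  "horizontal_grid_line V d m = {P. P $ 2 = V $ 2 + of_int m * d}"

definition adjacent_grid_lines :: "real^2 \<Rightarrow> real \<Rightarrow> (real^2) set \<Rightarrow> (real^2) set \<Rightarrow> bool" where
  "adjacent_grid_lines V d s t \<longleftrightarrow>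
     (\<exists>m n. \<bar>m - n\<bar> = 1 \<and>
        (s = vertical_grid_line V d m \<and> t = vertical_grid_line V d n \<or>
         s = horizontal_grid_line V d m \<and> t = horizontal_grid_line V d n))"

definition inverse_point :: "real^2 \<Rightarrow> real \<Rightarrow> real^2 \<Rightarrow> real^2 \<Rightarrow> bool" where
  "inverse_point A r X X' \<longleftrightarrow>
     X \<noteq> A \<and> (\<exists>u\<ge>0. X' = A + u *\<^sub>R (X - A)) \<and> dist A X * dist A X' = r\<^sup>2"

text \<open>
  The inverse of a straight line. The point \<open>A\<close> always belongs to it, as the inverse of the
  point at infinity of the line; if \<open>A\<close> lies on the line, its own inverse is the point at
  infinity, so that the line is mapped to itself.
\<close>

definition inverse_line :: "real^2 \<Rightarrow> real \<Rightarrow> (real^2) set \<Rightarrow> (real^2) set" where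
  "inverse_line A r s = insert A {X'. \<exists>X\<in>s. inverse_point A r X X'}"

text \<open>
  The signed curvature is only meaningful for straight lines and for circles through \<open>A\<close>
  centered at a point of one of the axes through \<open>A\<close>.
\<close>

definition signed_curvature :: "real^2 \<Rightarrow> (real^2) set \<Rightarrow> real" where
  "signed_curvature A K =
     (if affine K \<and> aff_dim K = 1 then 0
      else THE \<kappa>. \<exists>c \<rho>. 0 < \<rho> \<and> K = sphere c \<rho> \<and> A \<in> K \<and>
             (c $ 2 = A $ 2 \<and> \<kappa> = sgn (c $ 1 - A $ 1) * (1 / \<rho>) \<or>
              c $ 1 = A $ 1 \<and> \<kappa> = sgn (c $ 2 - A $ 2) * (1 / \<rho>)))"

lemma sphere_center_unique:
  fixes c c' :: "real^2"
  assumes "0 < \<rho>" "sphere c \<rho> = sphere c' \<rho>'"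
  shows "c = c'" "\<rho> = \<rho>'"
proof -
  show eq: "c = c'"
  proof (rule ccontr)
    assume ne: "c \<noteq> c'"
    define w where "w = (\<rho> / norm (c - c')) *\<^sub>R (c - c')"
    have nw: "norm w = \<rho>" using ne assms(1) by (simp add: w_def)
    have "c + w \<in> sphere c \<rho>" "c - w \<in> sphere c \<rho>"
      using nw by (simp_all add: dist_norm)
    then have "norm (c + w - c') = \<rho>'" "norm (c - w - c') = \<rho>'"
      unfolding assms(2) by (simp_all add: dist_norm norm_minus_commute)
    then have "(norm (c - c' + w))\<^sup>2 = (norm (c - c' - w))\<^sup>2"
      by (simp add: algebra_simps)
    then have "(c - c') \<bullet> w = 0"
      by (simp add: power2_norm_eq_inner inner_add_left inner_add_right
          inner_diff_left inner_diff_right inner_commute)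
    then show False
      using ne assms(1) by (simp add: w_def)
  qed
  have "c + \<rho> *\<^sub>R axis 1 1 \<in> sphere c \<rho>"
    using assms(1) by (simp add: dist_norm norm_axis_1)
  then show "\<rho> = \<rho>'"
    unfolding assms(2) using eq assms(1) by (simp add: dist_norm norm_axis_1)
qed

lemma sphere_not_affine:
  fixes c :: "real^2"
  assumes "0 < \<rho>"
  shows "\<not> affine (sphere c \<rho>)"
proof
  assume a: "affine (sphere c \<rho>)"
  have "c + \<rho> *\<^sub>R axis 1 1 \<in> sphere c \<rho>" "c - \<rho> *\<^sub>R axis 1 1 \<in> sphere c \<rho>"
    using assms by (simp_all add: dist_norm norm_axis_1)
  then have "(1/2) *\<^sub>R (c + \<rho> *\<^sub>R axis 1 1) + (1/2) *\<^sub>R (c - \<rho> *\<^sub>R axis 1 1) \<in> sphere c \<rho>"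
    using a unfolding affine_def by (metis field_sum_of_halves)
  moreover have "(1/2) *\<^sub>R (c + \<rho> *\<^sub>R axis 1 1) + (1/2) *\<^sub>R (c - \<rho> *\<^sub>R axis 1 1) = c"
    by (simp add: scaleR_add_right scaleR_diff_right flip: scaleR_add_left)
  ultimately show False using assms by simp
qed

lemma signed_curvature_line:
  "affine K \<Longrightarrow> aff_dim K = 1 \<Longrightarrow> signed_curvature A K = 0"
  by (simp add: signed_curvature_def)

lemma signed_curvature_circle:
  assumes "0 < \<rho>" "A \<in> sphere c \<rho>"
  shows "c $ 2 = A $ 2 \<Longrightarrow> signed_curvature A (sphere c \<rho>) = sgn (c $ 1 - A $ 1) * (1 / \<rho>)"
    and "c $ 1 = A $ 1 \<Longrightarrow> signed_curvature A (sphere c \<rho>) = sgn (c $ 2 - A $ 2) * (1 / \<rho>)"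
proof -
  have "c \<noteq> A" using assms by auto
  then have off: "\<not> (c $ 1 = A $ 1 \<and> c $ 2 = A $ 2)"
    by (simp add: vec_eq_iff forall_2)
  show "signed_curvature A (sphere c \<rho>) = sgn (c $ 1 - A $ 1) * (1 / \<rho>)" if "c $ 2 = A $ 2"
    unfolding signed_curvature_def using sphere_not_affine[OF assms(1)] assms that off
    by (auto intro!: the_equality dest: sphere_center_unique)
  show "signed_curvature A (sphere c \<rho>) = sgn (c $ 2 - A $ 2) * (1 / \<rho>)" if "c $ 1 = A $ 1"
    unfolding signed_curvature_def using sphere_not_affine[OF assms(1)] assms that off
    by (auto intro!: the_equality dest: sphere_center_unique)
qed

end

theory Submission
  imports Defs
begin

text \<open>
  Put \<open>Y = X' - A\<close>. The inverse of a line at signed distance \<open>a\<close> from \<open>A\<close> has the equation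
  \<open>r\<^sup>2 (Y \<bullet> e) = a \<bar>Y\<bar>\<^sup>2\<close>, where \<open>e\<close> is the unit normal of the line. It is the line itself for
  \<open>a = 0\<close> and a circle of signed radius \<open>r\<^sup>2 / (2 a)\<close> otherwise, so in both cases its signed
  curvature is \<open>2 a / r\<^sup>2\<close>, which is linear in \<open>a\<close>. Adjacent lines at distance \<open>d\<close> thus always
  give the difference \<open>2 d / r\<^sup>2\<close>.
\<close>

text \<open>Inversion is an involution, so the relation can be solved for \<open>X\<close>. Points
  of an inverse line are then found by substituting this \<open>X\<close> into the equation of the
  line.\<close>

lemma inverse_point_iff:
  assumes "r > 0"
  shows "inverse_point A r X X' \<longleftrightarrow>
    X' \<noteq> A \<and> X = A + (r\<^sup>2 / (norm (X' - A))\<^sup>2) *\<^sub>R (X' - A)"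
proof
  assume inv: "inverse_point A r X X'"
  then obtain u where u: "u \<ge> 0" "X' = A + u *\<^sub>R (X - A)" "X \<noteq> A"
    and prod: "dist A X * dist A X' = r\<^sup>2"
    by (auto simp: inverse_point_def)
  define n where "n = norm (X - A)"
  have "n > 0"
    using u(3) by (simp add: n_def)
  have eq: "u * n\<^sup>2 = r\<^sup>2"
    using prod u(1) by (simp add: u(2) n_def dist_norm norm_minus_commute[of A X] power2_eq_square mult_ac)
  then have "u > 0"
    using assms u(1) by (cases "u = 0") auto
  have "norm (X' - A) = u * n"
    using u by (simp add: n_def)
  then have "r\<^sup>2 / (norm (X' - A))\<^sup>2 = u * n\<^sup>2 / (u * n)\<^sup>2"
    by (simp add: eq)
  also have "\<dots> = 1 / u"
    using \<open>u > 0\<close> \<open>n > 0\<close> by (simp add: power_mult_distrib power2_eq_square)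
  finally have "r\<^sup>2 / (norm (X' - A))\<^sup>2 = 1 / u" .
  then show "X' \<noteq> A \<and> X = A + (r\<^sup>2 / (norm (X' - A))\<^sup>2) *\<^sub>R (X' - A)"
    using u \<open>u > 0\<close> by simp
next
  assume rhs: "X' \<noteq> A \<and> X = A + (r\<^sup>2 / (norm (X' - A))\<^sup>2) *\<^sub>R (X' - A)"
  define n where "n = norm (X' - A)"
  have "n > 0"
    using rhs by (simp add: n_def)
  have X: "X = A + (r\<^sup>2 / n\<^sup>2) *\<^sub>R (X' - A)"
    using rhs by (simp add: n_def)
  \<comment> \<open>The required ray factor \<open>u\<close> is the reciprocal of the factor that
    takes \<open>X' - A\<close> to \<open>X - A\<close>.\<close>
  have "X' = A + (n\<^sup>2 / r\<^sup>2) *\<^sub>R (X - A)"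
    using assms \<open>n > 0\<close> by (simp add: X)
  moreover have "dist A X * dist A X' = r\<^sup>2"
    using \<open>n > 0\<close> by (simp add: X dist_norm norm_minus_commute[of A X'] power2_eq_square flip: n_def)
  moreover have "X \<noteq> A"
    using assms rhs by (simp add: X n_def)
  ultimately show "inverse_point A r X X'"
    by (auto simp: inverse_point_def intro!: exI[of _ "n\<^sup>2 / r\<^sup>2"])
qed

text \<open>Away from \<open>A\<close>, substitute the inverse point and clear the denominator. The
  inserted point \<open>A\<close> fits the same equation, since both sides vanish there.\<close>

lemma inverse_line_coordinate_line:
  fixes A :: "real^2"
  assumes "r > 0"
  shows "inverse_line A r {P. P $ i = A $ i + a} =
    {P. r\<^sup>2 * (P $ i - A $ i) = a * (norm (P - A))\<^sup>2}"
proof -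
  have "r\<^sup>2 / (norm (P - A))\<^sup>2 * (P $ i - A $ i) = a \<longleftrightarrow>
      r\<^sup>2 * (P $ i - A $ i) = a * (norm (P - A))\<^sup>2" if "P \<noteq> A" for P
    using that by (simp add: field_simps)
  then show ?thesis
    by (auto simp: inverse_line_def inverse_point_iff[OF assms])
qed

lemma signed_curvature_inverse_coordinate_line:
  fixes A :: "real^2"
  assumes "r > 0"
  shows "signed_curvature A (inverse_line A r {P. P $ i = A $ i + a}) = 2 * a / r\<^sup>2"
proof (cases "a = 0")
  case True
  define e :: "real^2" where "e = axis i 1"
  have "inverse_line A r {P. P $ i = A $ i + a} = {P. e \<bullet> P = A $ i}"
    using assms inverse_line_coordinate_line[of r A i 0] by (simp add: True e_def inner_axis')
  moreover have "e \<noteq> 0"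
    by (simp add: e_def axis_eq_0_iff)
  ultimately show ?thesis
    using True by (simp add: signed_curvature_line affine_hyperplane aff_dim_hyperplane)
next
  case False
  \<comment> \<open>\<open>q\<close> is the signed radius: the foot of the perpendicular from
    \<open>A\<close>, at offset \<open>a\<close>, is inverted to the point diametrically opposite
    \<open>A\<close>, at offset \<open>2 * q = r^2 / a\<close>.\<close>
  define q where "q = r\<^sup>2 / (2 * a)"
  define c where "c = A + q *\<^sub>R axis i 1"
  have q: "q \<noteq> 0" "r\<^sup>2 = 2 * a * q"
    using False assms by (simp_all add: q_def)
  have "P \<in> sphere c \<bar>q\<bar> \<longleftrightarrow> r\<^sup>2 * (P $ i - A $ i) = a * (norm (P - A))\<^sup>2" for P
  proof -
    define Y where "Y = P - A"
    have "P - c = Y - q *\<^sub>R axis i 1"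
      by (simp add: c_def Y_def)
    then have "P \<in> sphere c \<bar>q\<bar> \<longleftrightarrow> norm (Y - q *\<^sub>R axis i 1) = \<bar>q\<bar>"
      by (simp add: dist_norm norm_minus_commute[of c])
    also have "\<dots> \<longleftrightarrow> (norm (Y - q *\<^sub>R axis i 1))\<^sup>2 = q\<^sup>2"
      using power2_eq_iff_nonneg[of "norm (Y - q *\<^sub>R axis i 1)" "\<bar>q\<bar>"] by simp
    also have "(norm (Y - q *\<^sub>R axis i 1))\<^sup>2 = (norm Y)\<^sup>2 - 2 * q * Y $ i + q\<^sup>2"
      by (simp only: power2_norm_eq_inner inner_diff_left inner_diff_right inner_scaleR_left
          inner_scaleR_right inner_axis inner_axis' axis_nth)
        (simp add: power2_eq_square algebra_simps)
    also have "\<dots> = q\<^sup>2 \<longleftrightarrow> 2 * q * Y $ i = (norm Y)\<^sup>2"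
      by linarith
    \<comment> \<open>Multiplying by the nonzero \<open>a\<close> makes the coefficient on the left
      \<open>2 * a * q = r^2\<close>.\<close>
    also have "\<dots> \<longleftrightarrow> a * (2 * q * Y $ i) = a * (norm Y)\<^sup>2"
      by (simp only: mult_cancel_left False simp_thms)
    also have "\<dots> \<longleftrightarrow> r\<^sup>2 * (P $ i - A $ i) = a * (norm (P - A))\<^sup>2"
      by (simp add: q(2) Y_def mult_ac)
    finally show ?thesis .
  qed
  then have circle: "inverse_line A r {P. P $ i = A $ i + a} = sphere c \<bar>q\<bar>"
    unfolding inverse_line_coordinate_line[OF assms] by blast
  have "A \<in> sphere c \<bar>q\<bar>"
    by (simp add: c_def dist_norm)
  moreover have "i = 1 \<or> i = 2"
    by (rule exhaust_2)
  ultimately have "signed_curvature A (sphere c \<bar>q\<bar>) = sgn q * (1 / \<bar>q\<bar>)"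
    using signed_curvature_circle[of "\<bar>q\<bar>" A c] q(1) by (auto simp: c_def axis_def)
  also have "\<dots> = 1 / q"
    by (simp add: sgn_if)
  also have "\<dots> = 2 * a / r\<^sup>2"
    by (simp add: q_def)
  finally show ?thesis
    by (simp add: circle)
qed

theorem theorem3p1:
  fixes V A :: "real^2" and d r :: real
  assumes "d > 0" and "r > 0"
  shows "\<exists>k. \<forall>s t. adjacent_grid_lines V d s t \<longrightarrow>
           \<bar>signed_curvature A (inverse_line A r t) - signed_curvature A (inverse_line A r s)\<bar> = k"
proof (intro exI allI impI)
  fix s t
  assume "adjacent_grid_lines V d s t"
  \<comment> \<open>The two directions differ only in the fixed coordinate, so an index
    \<open>i\<close> treats them together.\<close>
  then obtain m n :: int and i :: 2 where mn: "\<bar>m - n\<bar> = 1"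
    and st: "s = {P. P $ i = V $ i + of_int m * d}" "t = {P. P $ i = V $ i + of_int n * d}"
    unfolding adjacent_grid_lines_def vertical_grid_line_def horizontal_grid_line_def by blast
  \<comment> \<open>The offset from \<open>A\<close> is affine in \<open>l\<close>; its part
    \<open>V $ i - A $ i\<close> cancels in the difference, and so does the dependence on
    \<open>i\<close>.\<close>
  have curv: "signed_curvature A (inverse_line A r {P. P $ i = V $ i + of_int l * d}) =
      2 * (V $ i - A $ i + of_int l * d) / r\<^sup>2" for l :: int
    using signed_curvature_inverse_coordinate_line[OF assms(2), of A i "V $ i - A $ i + of_int l * d"]
    by (simp add: algebra_simps)
  have "\<bar>signed_curvature A (inverse_line A r t) - signed_curvature A (inverse_line A r s)\<bar> =
      \<bar>2 * d / r\<^sup>2 * of_int (n - m)\<bar>"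
    unfolding st curv by (simp add: diff_divide_distrib[symmetric] algebra_simps)
  also have "\<dots> = 2 * d / r\<^sup>2 * of_int \<bar>m - n\<bar>"
    using assms by (simp add: abs_mult abs_minus_commute)
  finally show "\<bar>signed_curvature A (inverse_line A r t) - signed_curvature A (inverse_line A r s)\<bar> =
      2 * d / r\<^sup>2"
    by (simp add: mn)
qed

end
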